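(* Let $(X,d)$ be a cone metric space over an ordered topological vector space $(E,\tau,\preceq)$ with a solid cone $C$. Let $f,g:X\to X$ be two self-mappings satisfying $fX\subset gX$, and assume that one of the two subsets $fX$, $gX$ of $X$ is complete. Suppose that one of the following conditions is satisfied: (1) (Banach) there is $\lambda\in(0,1)$ such that for all $x,y\in X$, $d(fx,fy)\preceq\lambda d(gx,gy)$; (2) (Kannan) there are $\lambda,\mu\ge0$ with $\lambda+\mu<1$ such that for all $x,y\in X$, $d(fx,fy)\preceq\lambda d(gx,fx)+\mu d(gy,fy)$; (3) (Chatterjea) there are $\lambda,\mu\ge0$ with $\lambda+\mu<1$ such that for all $x,y\in X$, $d(fx,fy)\preceq\lambda d(gx,fy)+\mu d(gy,fx)$; (4) (Reich) there are $\lambda,\mu,\nu\ge0$ with $\lambda+\mu+\nu<1$ such that for all $x,y\in X$, $d(fx,fy)\preceq\lambda d(gx,gy)+\mu d(gx,fx)+\nu d(gy,fy)$; (5) (Zamfirescu) there are constants $\lambda_1\in(0,1)$, $\lambda_2,\mu_2\ge0$ with $\lambda_2+\mu_2<1$, and $\lambda_3,\mu_3\ge0$ with $\lambda_3+\mu_3<1$ such that for all $x,y\in X$ at least one of the following holds: $d(fx,fy)\preceq\lambda_1 d(gx,gy)$; $d(fx,fy)\preceq\lambda_2 d(gx,fx)+\mu_2 d(gy,fy)$; $d(fx,fy)\preceq\lambda_3 d(gx,fy)+\mu_3 d(gy,fx)$; (6) (Hardy--Rogers) there are $\lambda,\mu,\nu,\xi,\pi\ge0$ with $\lambda+\mu+\nu+\xi+\pi<1$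 such that for all $x,y\in X$, $d(fx,fy)\preceq\lambda d(gx,gy)+\mu d(gx,fx)+\nu d(gy,fy)+\xi d(gx,fy)+\pi d(gy,fx)$; (7) (Ćirić) there is $\lambda\in(0,1)$ such that for all $x,y\in X$, $d(fx,fy)\preceq\lambda u(x,y)$ for some $u(x,y)$ belonging to one of the sets $$\left\{d(gx,gy),\tfrac{d(gx,fx)+d(gy,fy)}2,\tfrac{d(gx,fy)+d(gy,fx)}2\right\},$$ $$\left\{d(gx,gy),d(gx,fx),d(gy,fy),\tfrac{d(gx,fy)+d(gy,fx)}2\right\}.$$ Then $f$ and $g$ have a unique point of coincidence. Moreover, if $f$ and $g$ are weakly compatible, then they have a unique common fixed point in $X$.
   Context: $E$ is a real vector space with zero vector $\theta$ and a vector topology $\tau$. A cone $C\subset E$ is a set such that: (1) $C$ is closed, nonempty and $C\neq\{\theta\}$; (2) $x,y\in C$, $\lambda,\mu\ge0$ imply $\lambda x+\mu y\in C$; (3) $C\cap(-C)=\{\theta\}$. The order is $x\preceq y\iff y-x\in C$, and $(E,\tau,\preceq)$ is called an ordered topological vector space. $C$ is solid if $\operatorname{int} C\neq\emptyset$; write $x\ll y$ iff $y-x\in\operatorname{int} C$. A cone metric space over $(E,\tau,\preceq)$ is a nonempty set $X$ with a map $d:X\times X\to E$ such that for all $x,y,z\in X$: (i) $d(x,y)\succeq\theta$, and $d(x,y)=\theta$ iff $x=y$; (ii) $d(x,y)=d(y,x)$; (iii) $d(x,z)\preceq d(x,y)+d(y,z)$. A sequence $\{x_n\}$ converges to $x$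 if for each $c\in\operatorname{int} C$ there is $n_0$ with $d(x_n,x)\ll c$ for all $n\ge n_0$; it is Cauchy if for each $c\in\operatorname{int} C$ there is $n_0$ with $d(x_m,x_n)\ll c$ for all $m,n\ge n_0$. A subset $Y\subset X$ is complete if every Cauchy sequence in $Y$ converges to some point of $Y$. A point $w\in X$ is a point of coincidence of $f$ and $g$ if $w=fx=gx$ for some $x\in X$. The mappings $f$ and $g$ are weakly compatible if $fgx=gfx$ whenever $fx=gx$. A common fixed point is a point $x$ with $fx=gx=x$. *)

theory Defs
  imports "HOL-Analysis.Analysis"
begin

text \<open>Real vector spaces with a vector topology: both operations are jointly continuous.
  The Hausdorff property is not part of the notion.  (When a cone in the sense below exists,
  the space is Hausdorff, since the intersection of \<open>C\<close> and \<open>- C\<close> is closed.)\<close>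

class real_topological_vector = real_vector + topological_ab_group_add +
  assumes tendsto_scaleR_Pair:
    "LIM p (nhds a \<times>\<^sub>F nhds x). fst p *\<^sub>R snd p :> nhds (a *\<^sub>R x)"

instance real_normed_vector \<subseteq> real_topological_vector
proof
  fix a :: real and x :: 'a
  show "LIM p (nhds a \<times>\<^sub>F nhds x). fst p *\<^sub>R snd p :> nhds (a *\<^sub>R x)"
    by (intro tendsto_scaleR filterlim_fst filterlim_snd)
qed

text \<open>This is unrelated to the library constant \<^const>\<open>cone\<close>, which only asks for closure
  under nonnegative scaling.\<close>

definition is_cone :: "'e::real_topological_vector set \<Rightarrow> bool" where
  "is_cone C \<longleftrightarrow>
     closed C \<and> C \<noteq> {} \<and> C \<noteq> {0} \<and>
     (\<forall>x\<in>C. \<forall>y\<in>C. \<forall>a b::real. 0 \<le> a \<longrightarrow> 0 \<le> b \<longrightarrow> a *\<^sub>R x + b *\<^sub>R y \<in> C) \<and>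
     C \<inter> uminus ` C = {0}"

definition solid :: "'e::real_topological_vector set \<Rightarrow> bool" where
  "solid C \<longleftrightarrow> interior C \<noteq> {}"

definition cone_le :: "'e::real_topological_vector \<Rightarrow> 'e set \<Rightarrow> 'e \<Rightarrow> bool"
    (\<open>(_/ \<preceq>\<^bsub>_\<^esub> _)\<close> [51, 0, 51] 50) where
  "x \<preceq>\<^bsub>C\<^esub> y \<longleftrightarrow> y - x \<in> C"

definition cone_less :: "'e::real_topological_vector \<Rightarrow> 'e set \<Rightarrow> 'e \<Rightarrow> bool"
    (\<open>(_/ \<lless>\<^bsub>_\<^esub> _)\<close> [51, 0, 51] 50) where
  "x \<lless>\<^bsub>C\<^esub> y \<longleftrightarrow> y - x \<in> interior C"

locale cone_metric_space =
  fixes C :: "'e::real_topological_vector set"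
    and X :: "'x set"
    and d :: "'x \<Rightarrow> 'x \<Rightarrow> 'e"
  assumes cone: "is_cone C"
    and nonempty: "X \<noteq> {}"
    and nonneg: "\<lbrakk>x \<in> X; y \<in> X\<rbrakk> \<Longrightarrow> 0 \<preceq>\<^bsub>C\<^esub> d x y"
    and zero_iff: "\<lbrakk>x \<in> X; y \<in> X\<rbrakk> \<Longrightarrow> d x y = 0 \<longleftrightarrow> x = y"
    and sym: "\<lbrakk>x \<in> X; y \<in> X\<rbrakk> \<Longrightarrow> d x y = d y x"
    and triangle: "\<lbrakk>x \<in> X; y \<in> X; z \<in> X\<rbrakk> \<Longrightarrow> d x z \<preceq>\<^bsub>C\<^esub> d x y + d y z"

definition cone_converges ::
    "'e::real_topological_vector set \<Rightarrow> ('x \<Rightarrow> 'x \<Rightarrow> 'e) \<Rightarrow> (nat \<Rightarrow> 'x) \<Rightarrow> 'x \<Rightarrow> bool" where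
  "cone_converges C d s x \<longleftrightarrow> (\<forall>c\<in>interior C. \<exists>n0. \<forall>n\<ge>n0. d (s n) x \<lless>\<^bsub>C\<^esub> c)"

definition cone_Cauchy ::
    "'e::real_topological_vector set \<Rightarrow> ('x \<Rightarrow> 'x \<Rightarrow> 'e) \<Rightarrow> (nat \<Rightarrow> 'x) \<Rightarrow> bool" where
  "cone_Cauchy C d s \<longleftrightarrow> (\<forall>c\<in>interior C. \<exists>n0. \<forall>m\<ge>n0. \<forall>n\<ge>n0. d (s m) (s n) \<lless>\<^bsub>C\<^esub> c)"

definition cone_complete ::
    "'e::real_topological_vector set \<Rightarrow> ('x \<Rightarrow> 'x \<Rightarrow> 'e) \<Rightarrow> 'x set \<Rightarrow> bool" where
  "cone_complete C d Y \<longleftrightarrow>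
     (\<forall>s. (\<forall>n. s n \<in> Y) \<and> cone_Cauchy C d s \<longrightarrow> (\<exists>x\<in>Y. cone_converges C d s x))"

definition point_of_coincidence ::
    "'x set \<Rightarrow> ('x \<Rightarrow> 'x) \<Rightarrow> ('x \<Rightarrow> 'x) \<Rightarrow> 'x \<Rightarrow> bool" where
  "point_of_coincidence X f g w \<longleftrightarrow> w \<in> X \<and> (\<exists>x\<in>X. w = f x \<and> w = g x)"

definition weakly_compatible :: "'x set \<Rightarrow> ('x \<Rightarrow> 'x) \<Rightarrow> ('x \<Rightarrow> 'x) \<Rightarrow> bool" where
  "weakly_compatible X f g \<longleftrightarrow> (\<forall>x\<in>X. f x = g x \<longrightarrow> f (g x) = g (f x))"

definition common_fixed_point ::
    "'x set \<Rightarrow> ('x \<Rightarrow> 'x) \<Rightarrow> ('x \<Rightarrow> 'x) \<Rightarrow> 'x \<Rightarrow> bool" where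
  "common_fixed_point X f g x \<longleftrightarrow> x \<in> X \<and> f x = x \<and> g x = x"

end

theory Submission
  imports Defs
begin

text \<open>All seven conditions imply one symmetric condition whose coefficients may depend on the
  points: \<open>d (f x) (f y)\<close> is dominated by a combination of the five distances with total weight
  at most \<open>k < 1\<close>, and with equal weights on \<open>d (g x) (f y)\<close> and \<open>d (g y) (f x)\<close>.  The equal
  weights are obtained by averaging the condition for \<open>(x, y)\<close> and \<open>(y, x)\<close>.  Along a Jungck
  sequence, \<open>g (x (Suc n)) = f (x n)\<close>, this gives a contraction of consecutive distances by
  the factor \<open>k\<close>, hence a Cauchy sequence, whose limit \<open>g z\<close> satisfies
  \<open>d (g z) (f z) \<lless> c\<close> for every \<open>c\<close> in the interior of the cone.\<close>

section \<open>Solid cones in topological vector spaces\<close>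

lemma tendsto_scaleR_left_tvs:
  fixes v :: "'e::real_topological_vector"
  assumes "(u \<longlongrightarrow> a) F"
  shows "((\<lambda>i. u i *\<^sub>R v) \<longlongrightarrow> a *\<^sub>R v) F"
proof -
  have "LIM i F. (u i, v) :> nhds a \<times>\<^sub>F nhds v"
    using assms by (intro filterlim_Pair tendsto_const)
  from filterlim_compose[OF tendsto_scaleR_Pair this] show ?thesis by simp
qed

lemma continuous_on_scaleR_right_tvs:
  "continuous_on UNIV (\<lambda>x::'e::real_topological_vector. a *\<^sub>R x)"
proof -
  have "((\<lambda>y. a *\<^sub>R y) \<longlongrightarrow> a *\<^sub>R x) (at x)" for x :: 'e
  proof -
    have "LIM y at x. (a, y) :> nhds a \<times>\<^sub>F nhds x"
      by (intro filterlim_Pair tendsto_const tendsto_ident_at)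
    from filterlim_compose[OF tendsto_scaleR_Pair this] show ?thesis by simp
  qed
  then show ?thesis by (simp add: continuous_on_def)
qed

section \<open>Algebra of the cone order and openness arguments for the interior\<close>

context
  fixes C :: "'e::real_topological_vector set"
  assumes C: "is_cone C"
begin

lemma cone_add: "x \<in> C \<Longrightarrow> y \<in> C \<Longrightarrow> x + y \<in> C"
  using C unfolding is_cone_def by (metis scaleR_one zero_le_one)

lemma cone_scaleR: "x \<in> C \<Longrightarrow> 0 \<le> a \<Longrightarrow> a *\<^sub>R x \<in> C"
  using C unfolding is_cone_def by (metis add.right_neutral order_refl scaleR_zero_left)

lemma cone_zero: "0 \<in> C"
  using C unfolding is_cone_def by blast

lemma cone_antisym: "x \<in> C \<Longrightarrow> - x \<in> C \<Longrightarrow> x = 0"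
  using C unfolding is_cone_def by (metis IntI add.inverse_inverse image_eqI singletonD)

lemma cone_le_trans: "x \<preceq>\<^bsub>C\<^esub> y \<Longrightarrow> y \<preceq>\<^bsub>C\<^esub> z \<Longrightarrow> x \<preceq>\<^bsub>C\<^esub> z"
  unfolding cone_le_def using cone_add[of "y - x" "z - y"] by simp

lemma cone_le_add: "x \<preceq>\<^bsub>C\<^esub> y \<Longrightarrow> x' \<preceq>\<^bsub>C\<^esub> y' \<Longrightarrow> x + x' \<preceq>\<^bsub>C\<^esub> y + y'"
  unfolding cone_le_def using cone_add[of "y - x" "y' - x'"] by (simp add: algebra_simps)

lemma cone_le_scaleR: "x \<preceq>\<^bsub>C\<^esub> y \<Longrightarrow> 0 \<le> a \<Longrightarrow> a *\<^sub>R x \<preceq>\<^bsub>C\<^esub> a *\<^sub>R y"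
  unfolding cone_le_def using cone_scaleR[of "y - x" a] by (simp add: algebra_simps)

lemma cone_le_scaleR_cancel: "a *\<^sub>R x \<preceq>\<^bsub>C\<^esub> b *\<^sub>R y \<Longrightarrow> 0 < a \<Longrightarrow> x \<preceq>\<^bsub>C\<^esub> (b / a) *\<^sub>R y"
  using cone_le_scaleR[of "a *\<^sub>R x" "b *\<^sub>R y" "inverse a"] by (simp add: field_simps)

lemma cone_le_scaleR_left: "x \<in> C \<Longrightarrow> a \<le> b \<Longrightarrow> a *\<^sub>R x \<preceq>\<^bsub>C\<^esub> b *\<^sub>R x"
  unfolding cone_le_def using cone_scaleR[of x "b - a"] by (simp add: algebra_simps)

text \<open>The translate of \<open>interior C\<close> by \<open>y\<close> is open, and
  \<open>cone_add\<close> places it inside \<open>C\<close>; by maximality of the interior it lies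
  in \<open>interior C\<close>.\<close>

lemma interior_cone_add:
  assumes "x \<in> interior C" "y \<in> C"
  shows "x + y \<in> interior C"
proof -
  let ?T = "(\<lambda>z. z + (- y)) -` interior C"
  have "?T \<subseteq> interior C"
  proof (rule interior_maximal)
    show "open ?T"
      by (intro open_vimage open_interior continuous_intros)
    show "?T \<subseteq> C"
      using cone_add[OF _ assms(2)] interior_subset[of C] by fastforce
  qed
  with assms show ?thesis by auto
qed

text \<open>The same maximality argument as for sums, with the dilate of \<open>interior C\<close>
  by \<open>a\<close>, which is open as the preimage under the continuous scaling by
  \<open>inverse a\<close>.\<close>

lemma interior_cone_scaleR:
  assumes "x \<in> interior C" "0 < a"
  shows "a *\<^sub>R x \<in> interior C"
proof -
  let ?T = "(\<lambda>z. inverse a *\<^sub>R z) -` interior C"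
  have "?T \<subseteq> interior C"
  proof (rule interior_maximal)
    show "open ?T"
      by (intro open_vimage open_interior continuous_on_scaleR_right_tvs)
    show "?T \<subseteq> C"
    proof
      fix z assume "z \<in> ?T"
      then have "inverse a *\<^sub>R z \<in> C" using interior_subset by auto
      from cone_scaleR[OF this, of a] assms show "z \<in> C" by simp
    qed
  qed
  with assms show ?thesis by auto
qed

lemma cone_le_less_trans: "x \<preceq>\<^bsub>C\<^esub> y \<Longrightarrow> y \<lless>\<^bsub>C\<^esub> z \<Longrightarrow> x \<lless>\<^bsub>C\<^esub> z"
  unfolding cone_le_def cone_less_def using interior_cone_add[of "z - y" "y - x"] by simp

lemma cone_less_imp_le: "x \<lless>\<^bsub>C\<^esub> y \<Longrightarrow> x \<preceq>\<^bsub>C\<^esub> y"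
  unfolding cone_le_def cone_less_def using interior_subset by blast

text \<open>The vectors \<open>c - u i *\<^sub>R v\<close> tend to \<open>c\<close>, so they
  eventually enter the open set \<open>interior C\<close>. This takes the place of a norm estimate
  when scalar rates are turned into \<lless>-bounds.\<close>

lemma eventually_scaleR_cone_less:
  assumes "(u \<longlongrightarrow> 0) F" "c \<in> interior C"
  shows "eventually (\<lambda>i. u i *\<^sub>R v \<lless>\<^bsub>C\<^esub> c) F"
proof -
  have "((\<lambda>i. c - u i *\<^sub>R v) \<longlongrightarrow> c - 0 *\<^sub>R v) F"
    by (intro tendsto_diff tendsto_const tendsto_scaleR_left_tvs assms)
  then have "((\<lambda>i. c - u i *\<^sub>R v) \<longlongrightarrow> c) F" by simp
  from topological_tendstoD[OF this open_interior assms(2)] show ?thesis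
    by (simp add: cone_less_def)
qed

text \<open>An interior point can be shrunk by the factors 1/(n+1) without leaving the interior.
  Since \<open>C\<close> is closed, passing to the limit in \<open>c/(n+1) - x\<close> gives
  \<open>- x \<in> C\<close>, and antisymmetry finishes.\<close>

lemma cone_eq_0_if_le_interior:
  assumes "solid C" "x \<in> C" "\<And>c. c \<in> interior C \<Longrightarrow> x \<preceq>\<^bsub>C\<^esub> c"
  shows "x = 0"
proof -
  obtain c where c: "c \<in> interior C" using assms(1) by (auto simp: solid_def)
  have lim: "(\<lambda>n. inverse (real (Suc n)) *\<^sub>R c - x) \<longlonglongrightarrow> 0 *\<^sub>R c - x"
    by (intro tendsto_diff tendsto_const tendsto_scaleR_left_tvs LIMSEQ_inverse_real_of_nat)
  have "inverse (real (Suc n)) *\<^sub>R c - x \<in> C" for n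
    using assms(3)[OF interior_cone_scaleR[OF c, of "inverse (real (Suc n))"]]
    by (simp add: cone_le_def)
  moreover have "closed C" using C by (simp add: is_cone_def)
  ultimately have "0 *\<^sub>R c - x \<in> C"
    using Lim_in_closed_set[OF _ _ sequentially_bot lim] by simp
  with assms(2) show ?thesis using cone_antisym by simp
qed

text \<open>The hypothesis says that \<open>(1 - k) *\<^sub>R (- x)\<close> is in \<open>C\<close>.
  Dividing by the positive number \<open>1 - k\<close> leaves \<open>- x \<in> C\<close>.\<close>

lemma cone_eq_0_if_le_scaleR:
  assumes "x \<in> C" "x \<preceq>\<^bsub>C\<^esub> k *\<^sub>R x" "k < 1"
  shows "x = 0"
proof -
  have "inverse (1 - k) *\<^sub>R (k *\<^sub>R x - x) \<in> C"
    using cone_scaleR assms by (simp add: cone_le_def)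
  moreover have "k *\<^sub>R x - x = (1 - k) *\<^sub>R (- x)" by (simp add: algebra_simps)
  ultimately have "- x \<in> C" using assms(3) by simp
  with assms(1) show ?thesis by (rule cone_antisym)
qed

end

section \<open>Cauchy sequences and coincidence points\<close>

context cone_metric_space
begin

lemma dist_in_cone: "x \<in> X \<Longrightarrow> y \<in> X \<Longrightarrow> d x y \<in> C"
  using nonneg by (simp add: cone_le_def)

text \<open>Iterating the step and summing by the triangle inequality bounds every later distance
  from \<open>s n\<close> by \<open>k ^ n / (1 - k)\<close> times one fixed vector of the cone.
  These scalars tend to 0, so the multiples fall below any interior point.\<close>

lemma geometric_imp_Cauchy:
  assumes s: "\<And>n. s n \<in> X" and k: "0 \<le> k" "k < 1"
    and step: "\<And>n. d (s (Suc n)) (s (Suc (Suc n))) \<preceq>\<^bsub>C\<^esub> k *\<^sub>R d (s n) (s (Suc n))"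
  shows "cone_Cauchy C d s"
proof -
  let ?D = "d (s 0) (s (Suc 0))"
  have D: "?D \<in> C" using dist_in_cone s by blast
  have pow: "d (s n) (s (Suc n)) \<preceq>\<^bsub>C\<^esub> (k ^ n) *\<^sub>R ?D" for n
  proof (induction n)
    case 0
    show ?case using cone_zero[OF cone] by (simp add: cone_le_def)
  next
    case (Suc n)
    from cone_le_trans[OF cone step cone_le_scaleR[OF cone Suc k(1)]] show ?case by simp
  qed
  have partial: "d (s n) (s (n + j)) \<preceq>\<^bsub>C\<^esub> (\<Sum>i<j. k ^ (n + i)) *\<^sub>R ?D" for n j
  proof (induction j)
    case 0
    have "d (s n) (s n) = 0" using zero_iff[OF s s] by simp
    then show ?case using cone_zero[OF cone] by (simp add: cone_le_def)
  next
    case (Suc j)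
    have "d (s n) (s (n + j)) + d (s (n + j)) (s (n + Suc j))
        \<preceq>\<^bsub>C\<^esub> (\<Sum>i<j. k ^ (n + i)) *\<^sub>R ?D + k ^ (n + j) *\<^sub>R ?D"
      using cone_le_add[OF cone Suc pow[of "n + j"]] by simp
    from cone_le_trans[OF cone triangle[OF s s s] this] show ?case
      by (simp add: scaleR_left_distrib)
  qed
  have bound: "d (s n) (s (n + j)) \<preceq>\<^bsub>C\<^esub> (k ^ n / (1 - k)) *\<^sub>R ?D" for n j
  proof -
    have "(\<Sum>i<j. k ^ (n + i)) = k ^ n * ((1 - k ^ j) / (1 - k))"
      using k by (simp add: power_add sum_distrib_left[symmetric] sum_gp_strict)
    also have "\<dots> \<le> k ^ n / (1 - k)"
      using k by (simp add: divide_right_mono mult_left_le)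
    finally show ?thesis
      by (rule cone_le_trans[OF cone partial cone_le_scaleR_left[OF cone D]])
  qed
  show ?thesis
    unfolding cone_Cauchy_def
  proof
    fix c assume c: "c \<in> interior C"
    have "(\<lambda>n. k ^ n / (1 - k)) \<longlonglongrightarrow> 0 / (1 - k)"
      using k by (intro tendsto_divide LIMSEQ_realpow_zero tendsto_const) auto
    then have "eventually (\<lambda>n. (k ^ n / (1 - k)) *\<^sub>R ?D \<lless>\<^bsub>C\<^esub> c) sequentially"
      using eventually_scaleR_cone_less[OF cone _ c] by simp
    then obtain n0 where n0: "\<And>n. n \<ge> n0 \<Longrightarrow> (k ^ n / (1 - k)) *\<^sub>R ?D \<lless>\<^bsub>C\<^esub> c"
      unfolding eventually_sequentially by blast
    \<comment> \<open>The bound treats only ordered pairs of indices; the remaining pairs follow by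
      symmetry of \<open>d\<close>.\<close>
    have le: "d (s m) (s n) \<lless>\<^bsub>C\<^esub> c" if "n0 \<le> m" "m \<le> n" for m n
      using cone_le_less_trans[OF cone bound[of m "n - m"] n0[of m]] that by simp
    have "d (s m) (s n) \<lless>\<^bsub>C\<^esub> c" if "n0 \<le> m" "n0 \<le> n" for m n
      using le[of m n] le[of n m] that sym[OF s s, of m n] by (cases "m \<le> n") auto
    then show "\<exists>n0. \<forall>m\<ge>n0. \<forall>n\<ge>n0. d (s m) (s n) \<lless>\<^bsub>C\<^esub> c" by blast
  qed
qed

text \<open>Only \<open>k\<close> is uniform: the four weights are chosen anew for each pair of
  points. The weight \<open>e\<close> counts twice in the total because it multiplies a sum of two
  distances.\<close>

definition dominated :: "real \<Rightarrow> ('x \<Rightarrow> 'x) \<Rightarrow> ('x \<Rightarrow> 'x) \<Rightarrow> 'x \<Rightarrow> 'x \<Rightarrow> bool" where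
  "dominated k f g x y \<longleftrightarrow> (\<exists>a b c e. 0 \<le> a \<and> 0 \<le> b \<and> 0 \<le> c \<and> 0 \<le> e \<and> a + b + c + 2 * e \<le> k \<and>
     d (f x) (f y) \<preceq>\<^bsub>C\<^esub> a *\<^sub>R d (g x) (g y) + b *\<^sub>R d (g x) (f x) + c *\<^sub>R d (g y) (f y)
       + e *\<^sub>R (d (g x) (f y) + d (g y) (f x)))"

section \<open>Jungck sequences and points of coincidence under domination with
  \<open>k < 1\<close>\<close>

context
  fixes f g :: "'x \<Rightarrow> 'x" and k :: real
  assumes f: "f \<in> X \<rightarrow> X" and g: "g \<in> X \<rightarrow> X" and k: "0 \<le> k" "k < 1"
    and dom: "\<And>x y. x \<in> X \<Longrightarrow> y \<in> X \<Longrightarrow> dominated k f g x y"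
begin

lemma Jungck_step:
  assumes x: "x \<in> X" and y: "y \<in> X" and gy: "g y = f x"
  shows "d (f x) (f y) \<preceq>\<^bsub>C\<^esub> k *\<^sub>R d (g x) (f x)"
proof -
  from dom[OF x y] gy obtain a b c e where nn: "0 \<le> a" "0 \<le> b" "0 \<le> c" "0 \<le> e"
    and sum: "a + b + c + 2 * e \<le> k"
    and le: "d (f x) (f y) \<preceq>\<^bsub>C\<^esub> a *\<^sub>R d (g x) (f x) + b *\<^sub>R d (g x) (f x) + c *\<^sub>R d (f x) (f y)
       + e *\<^sub>R (d (g x) (f y) + d (f x) (f x))"
    by (auto simp: dominated_def)
  have X: "f x \<in> X" "f y \<in> X" "g x \<in> X" using f g x y by auto
  let ?p = "d (g x) (f x)" and ?q = "d (f x) (f y)" and ?r = "d (g x) (f y)"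
  have "d (f x) (f x) = 0" using zero_iff X by blast
  with le have "(a *\<^sub>R ?p + b *\<^sub>R ?p + c *\<^sub>R ?q + e *\<^sub>R ?r - ?q) \<in> C"
    by (simp add: cone_le_def)
  moreover have "e *\<^sub>R (?p + ?q - ?r) \<in> C"
    using triangle[OF X(3,1,2)] cone_scaleR[OF cone _ nn(4)] by (simp add: cone_le_def)
  ultimately have "a *\<^sub>R ?p + b *\<^sub>R ?p + c *\<^sub>R ?q + e *\<^sub>R ?r - ?q + e *\<^sub>R (?p + ?q - ?r) \<in> C"
    by (rule cone_add[OF cone])
  then have "(1 - c - e) *\<^sub>R ?q \<preceq>\<^bsub>C\<^esub> (a + b + e) *\<^sub>R ?p"
    by (simp add: cone_le_def algebra_simps)
  moreover have pos: "0 < 1 - c - e" using nn sum k by linarith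
  ultimately have le': "?q \<preceq>\<^bsub>C\<^esub> ((a + b + e) / (1 - c - e)) *\<^sub>R ?p"
    by (rule cone_le_scaleR_cancel[OF cone])
  have "(a + b + e) / (1 - c - e) \<le> k"
  proof -
    \<comment> \<open>Hence \<open>a + b + e \<le> k - (c + e) \<le> k - k * (c + e)\<close>, where
      the first inequality is the weight bound \<open>sum\<close>.\<close>
    have "k * (c + e) \<le> c + e" using nn k by (intro mult_left_le_one_le) auto
    then have "a + b + e \<le> k * (1 - c - e)" using sum by (simp add: algebra_simps)
    then show ?thesis using pos by (simp add: divide_le_eq)
  qed
  then show ?thesis
    by (rule cone_le_trans[OF cone le' cone_le_scaleR_left[OF cone dist_in_cone[OF X(3,1)]]])
qed

lemma coincidence_estimate:
  assumes x: "x \<in> X" and z: "z \<in> X"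
  shows "(1 - k) *\<^sub>R d (g z) (f z) \<preceq>\<^bsub>C\<^esub> 2 *\<^sub>R d (g x) (g z) + 3 *\<^sub>R d (f x) (g z)"
proof -
  from dom[OF x z] obtain a b c e where nn: "0 \<le> a" "0 \<le> b" "0 \<le> c" "0 \<le> e"
    and sum: "a + b + c + 2 * e \<le> k"
    and le: "d (f x) (f z) \<preceq>\<^bsub>C\<^esub> a *\<^sub>R d (g x) (g z) + b *\<^sub>R d (g x) (f x) + c *\<^sub>R d (g z) (f z)
       + e *\<^sub>R (d (g x) (f z) + d (g z) (f x))"
    by (auto simp: dominated_def)
  have X: "f x \<in> X" "f z \<in> X" "g x \<in> X" "g z \<in> X" using f g x z by auto
  let ?\<delta> = "d (g z) (f z)" and ?p = "d (g x) (g z)" and ?q = "d (f x) (g z)"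
    and ?r = "d (f x) (f z)" and ?s = "d (g x) (f x)" and ?t = "d (g x) (f z)"
  have gf: "d (g z) (f x) = ?q" using sym X by blast
  have 1: "a *\<^sub>R ?p + b *\<^sub>R ?s + c *\<^sub>R ?\<delta> + e *\<^sub>R (?t + ?q) - ?r \<in> C"
    using le gf by (simp add: cone_le_def)
  have 2: "?q + ?r - ?\<delta> \<in> C"
    using triangle[OF X(4,1,2)] gf by (simp add: cone_le_def)
  have 3: "b *\<^sub>R (?p + ?q - ?s) \<in> C"
    using triangle[OF X(3,4,1)] gf cone_scaleR[OF cone _ nn(2)] by (simp add: cone_le_def)
  have 4: "e *\<^sub>R (?p + ?\<delta> - ?t) \<in> C"
    using triangle[OF X(3,4,2)] cone_scaleR[OF cone _ nn(4)] by (simp add: cone_le_def)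
  \<comment> \<open>These are the slack terms that turn the weight-dependent coefficients into the
    uniform ones.\<close>
  have 5: "(k - c - e) *\<^sub>R ?\<delta> \<in> C" "(2 - a - b - e) *\<^sub>R ?p \<in> C" "(2 - b - e) *\<^sub>R ?q \<in> C"
    using nn sum k by (auto intro!: cone_scaleR[OF cone] dist_in_cone X)
  have "(a *\<^sub>R ?p + b *\<^sub>R ?s + c *\<^sub>R ?\<delta> + e *\<^sub>R (?t + ?q) - ?r) + (?q + ?r - ?\<delta>)
      + b *\<^sub>R (?p + ?q - ?s) + e *\<^sub>R (?p + ?\<delta> - ?t)
      + (k - c - e) *\<^sub>R ?\<delta> + (2 - a - b - e) *\<^sub>R ?p + (2 - b - e) *\<^sub>R ?q \<in> C"
    by (intro cone_add[OF cone] 1 2 3 4 5)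
  also have "(a *\<^sub>R ?p + b *\<^sub>R ?s + c *\<^sub>R ?\<delta> + e *\<^sub>R (?t + ?q) - ?r) + (?q + ?r - ?\<delta>)
      + b *\<^sub>R (?p + ?q - ?s) + e *\<^sub>R (?p + ?\<delta> - ?t)
      + (k - c - e) *\<^sub>R ?\<delta> + (2 - a - b - e) *\<^sub>R ?p + (2 - b - e) *\<^sub>R ?q
      = (2 *\<^sub>R ?p + 3 *\<^sub>R ?q) - (1 - k) *\<^sub>R ?\<delta>"
  proof -
    have "3 *\<^sub>R ?q = 2 *\<^sub>R ?q + ?q" using scaleR_left_distrib[of 2 1 ?q] by simp
    then show ?thesis by (simp add: algebra_simps)
  qed
  finally show ?thesis by (simp add: cone_le_def)
qed

text \<open>At two coincidence points the terms with \<open>b\<close> and \<open>c\<close> vanish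
  and the other distances all equal \<open>d (f x) (f y)\<close>. This distance is thus below
  \<open>a + 2 * e < 1\<close> times itself.\<close>

lemma coincidence_unique:
  assumes x: "x \<in> X" "f x = g x" and y: "y \<in> X" "f y = g y"
  shows "f x = f y"
proof -
  from dom[OF x(1) y(1)] x y obtain a b c e where nn: "0 \<le> a" "0 \<le> b" "0 \<le> c" "0 \<le> e"
    and sum: "a + b + c + 2 * e \<le> k"
    and le: "d (f x) (f y) \<preceq>\<^bsub>C\<^esub> a *\<^sub>R d (f x) (f y) + b *\<^sub>R d (f x) (f x) + c *\<^sub>R d (f y) (f y)
       + e *\<^sub>R (d (f x) (f y) + d (f y) (f x))"
    by (auto simp: dominated_def)
  have X: "f x \<in> X" "f y \<in> X" using funcset_mem[OF f] x(1) y(1) by blast+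
  have "d (f x) (f x) = 0" "d (f y) (f y) = 0" "d (f y) (f x) = d (f x) (f y)"
    using X zero_iff sym by blast+
  with le have "d (f x) (f y) \<preceq>\<^bsub>C\<^esub> (a + 2 * e) *\<^sub>R d (f x) (f y)"
    by (simp add: algebra_simps scaleR_2[symmetric])
  then have "d (f x) (f y) = 0"
    using cone_eq_0_if_le_scaleR[OF cone dist_in_cone[OF X]] nn sum k by simp
  then show ?thesis using zero_iff X by blast
qed

lemma coincidence_exists:
  assumes solid: "solid C" and fg: "f ` X \<subseteq> g ` X"
    and complete: "cone_complete C d (f ` X) \<or> cone_complete C d (g ` X)"
  shows "\<exists>z\<in>X. f z = g z"
proof -
  \<comment> \<open>\<open>h x\<close> is a \<open>g\<close>-preimage of \<open>f x\<close>,
    available since \<open>f\<close> X \<subseteq> g \<open>X\<close>. Its iterates form the Jungck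
    sequence.\<close>
  define h where "h = (\<lambda>x. inv_into X g (f x))"
  have h: "h x \<in> X" "g (h x) = f x" if "x \<in> X" for x
    using fg that by (auto simp: h_def intro!: inv_into_into f_inv_into_f)
  obtain x0 where x0: "x0 \<in> X" using nonempty by blast
  define u where "u n = (h ^^ n) x0" for n
  have u: "u n \<in> X" for n by (induction n) (simp_all add: u_def x0 h)
  have gu: "g (u (Suc n)) = f (u n)" for n using h(2)[OF u[of n]] by (simp add: u_def)
  have fu: "f (u n) \<in> X" for n using funcset_mem[OF f u] .
  have "d (f (u (Suc n))) (f (u (Suc (Suc n)))) \<preceq>\<^bsub>C\<^esub> k *\<^sub>R d (f (u n)) (f (u (Suc n)))" for n
    \<comment> \<open>The index is shifted so that \<open>g (u (Suc n))\<close> can be rewritten to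
      \<open>f (u n)\<close>, making the right-hand side a distance of consecutive terms.\<close>
    using Jungck_step[OF u u gu, of "Suc n"] gu by simp
  then have Cauchy: "cone_Cauchy C d (\<lambda>n. f (u n))"
    by (rule geometric_imp_Cauchy[OF fu k])
  have mem_f: "f (u n) \<in> f ` X" for n by (rule imageI[OF u])
  have mem_g: "f (u n) \<in> g ` X" for n by (rule subsetD[OF fg mem_f])
  have "\<exists>w \<in> g ` X. cone_converges C d (\<lambda>n. f (u n)) w"
    using complete
  proof
    assume "cone_complete C d (f ` X)"
    then have "\<exists>w \<in> f ` X. cone_converges C d (\<lambda>n. f (u n)) w"
      unfolding cone_complete_def using Cauchy mem_f by metis
    then show ?thesis using fg by blast
  next
    assume "cone_complete C d (g ` X)"
    then show ?thesis unfolding cone_complete_def using Cauchy mem_g by metis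
  qed
  then obtain z where z: "z \<in> X" and conv: "cone_converges C d (\<lambda>n. f (u n)) (g z)"
    by auto
  have zX: "g z \<in> X" "f z \<in> X" using funcset_mem[OF g z] funcset_mem[OF f z] .
  have "d (g z) (f z) \<preceq>\<^bsub>C\<^esub> c" if c: "c \<in> interior C" for c
  proof -
    \<comment> \<open>The 5 is the sum of the constants 2 and 3 of
      \<open>coincidence_estimate\<close>, and \<open>1 - k\<close> is its left-hand factor.\<close>
    define c' where "c' = ((1 - k) / 5) *\<^sub>R c"
    have "c' \<in> interior C" unfolding c'_def using interior_cone_scaleR[OF cone c] k by simp
    with conv obtain n where n: "\<And>m. m \<ge> n \<Longrightarrow> d (f (u m)) (g z) \<lless>\<^bsub>C\<^esub> c'"
      unfolding cone_converges_def by metis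
    have le: "d (f (u m)) (g z) \<preceq>\<^bsub>C\<^esub> c'" if "m \<ge> n" for m
      using cone_less_imp_le[OF cone n[OF that]] .
    \<comment> \<open>At \<open>x = u (Suc n)\<close> we have \<open>g x = f (u n)\<close>, so both
      distances on the right run from terms of the convergent sequence with index at least
      \<open>n\<close>.\<close>
    have 1: "(1 - k) *\<^sub>R d (g z) (f z)
        \<preceq>\<^bsub>C\<^esub> 2 *\<^sub>R d (f (u n)) (g z) + 3 *\<^sub>R d (f (u (Suc n))) (g z)"
      using coincidence_estimate[OF u z, of "Suc n"] gu by simp
    have 2: "2 *\<^sub>R d (f (u n)) (g z) + 3 *\<^sub>R d (f (u (Suc n))) (g z)
        \<preceq>\<^bsub>C\<^esub> 2 *\<^sub>R c' + 3 *\<^sub>R c'"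
      by (intro cone_le_add[OF cone] cone_le_scaleR[OF cone] le) auto
    have "2 *\<^sub>R c' + 3 *\<^sub>R c' = (1 - k) *\<^sub>R c"
      unfolding c'_def scaleR_left_distrib[symmetric] by simp
    with cone_le_trans[OF cone 1 2]
    have "(1 - k) *\<^sub>R d (g z) (f z) \<preceq>\<^bsub>C\<^esub> (1 - k) *\<^sub>R c" by simp
    from cone_le_scaleR_cancel[OF cone this] show ?thesis using k by simp
  qed
  then have "d (g z) (f z) = 0"
    by (rule cone_eq_0_if_le_interior[OF cone solid dist_in_cone[OF zX]])
  then have "f z = g z" using zero_iff[OF zX] by simp
  with z show ?thesis ..
qed

lemma coincidence_and_common_fixed_point:
  assumes "solid C" "f ` X \<subseteq> g ` X" "cone_complete C d (f ` X) \<or> cone_complete C d (g ` X)"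
  shows "(\<exists>!w. point_of_coincidence X f g w) \<and>
         (weakly_compatible X f g \<longrightarrow> (\<exists>!x. common_fixed_point X f g x))"
proof -
  obtain z where z: "z \<in> X" "f z = g z" using coincidence_exists[OF assms] by blast
  have fz: "f z \<in> X" using funcset_mem[OF f z(1)] .
  have "\<exists>!w. point_of_coincidence X f g w"
  proof (rule ex1I)
    show "point_of_coincidence X f g (f z)"
      using z fz unfolding point_of_coincidence_def by metis
    show "w = f z" if "point_of_coincidence X f g w" for w
      using that coincidence_unique[OF _ _ z] by (auto simp: point_of_coincidence_def)
  qed
  moreover have "\<exists>!x. common_fixed_point X f g x" if wc: "weakly_compatible X f g"
  proof (rule ex1I)
    \<comment> \<open>Weak compatibility makes the value \<open>f z\<close> itself a coincidence
      point; uniqueness then forces its image \<open>f (f z)\<close> to be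
      \<open>f z\<close>.\<close>
    have eq: "f (f z) = g (f z)" using wc z unfolding weakly_compatible_def by metis
    then have "f (f z) = f z" using coincidence_unique[OF fz _ z] by blast
    then show "common_fixed_point X f g (f z)" using fz eq by (simp add: common_fixed_point_def)
    show "x = f z" if "common_fixed_point X f g x" for x
      using that coincidence_unique[OF _ _ z, of x] by (simp add: common_fixed_point_def)
  qed
  ultimately show ?thesis by blast
qed

end

section \<open>The contraction conditions\<close>

lemma dominatedI:
  assumes "0 \<le> a" "0 \<le> b" "0 \<le> c" "0 \<le> e" "a + b + c + 2 * e \<le> k"
    and "d (f x) (f y) \<preceq>\<^bsub>C\<^esub> a *\<^sub>R d (g x) (g y) + b *\<^sub>R d (g x) (f x) + c *\<^sub>R d (g y) (f y)
       + e *\<^sub>R (d (g x) (f y) + d (g y) (f x))"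
  shows "dominated k f g x y"
  using assms unfolding dominated_def by blast

text \<open>Averaging the two orders replaces \<open>b\<close>, \<open>c\<close> by their mean and
  \<open>p\<close>, \<open>q\<close> by theirs. With \<open>e = (p + q) / 2\<close> the total weight
  is unchanged.\<close>

lemma dominated_Hardy_Rogers:
  assumes X: "f x \<in> X" "f y \<in> X" "g x \<in> X" "g y \<in> X"
    and nn: "0 \<le> a" "0 \<le> b" "0 \<le> c" "0 \<le> p" "0 \<le> q" and sum: "a + b + c + p + q \<le> k"
    and xy: "d (f x) (f y) \<preceq>\<^bsub>C\<^esub> a *\<^sub>R d (g x) (g y) + b *\<^sub>R d (g x) (f x) + c *\<^sub>R d (g y) (f y)
       + p *\<^sub>R d (g x) (f y) + q *\<^sub>R d (g y) (f x)"
    and yx: "d (f y) (f x) \<preceq>\<^bsub>C\<^esub> a *\<^sub>R d (g y) (g x) + b *\<^sub>R d (g y) (f y) + c *\<^sub>R d (g x) (f x)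
       + p *\<^sub>R d (g y) (f x) + q *\<^sub>R d (g x) (f y)"
  shows "dominated k f g x y"
proof (rule dominatedI)
  let ?r = "d (f x) (f y)" and ?A = "d (g x) (g y)" and ?B = "d (g x) (f x)"
    and ?D = "d (g y) (f y)" and ?P = "d (g x) (f y)" and ?Q = "d (g y) (f x)"
  have "d (f y) (f x) = ?r" "d (g y) (g x) = ?A" using sym X by blast+
  with yx have yx': "?r \<preceq>\<^bsub>C\<^esub> a *\<^sub>R ?A + b *\<^sub>R ?D + c *\<^sub>R ?B + p *\<^sub>R ?Q + q *\<^sub>R ?P" by simp
  have *: "(1/2) *\<^sub>R u + (1/2) *\<^sub>R u = u" for u :: 'e
    unfolding scaleR_left_distrib[symmetric] by simp
  have "(1/2) *\<^sub>R ?r + (1/2) *\<^sub>R ?r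
      \<preceq>\<^bsub>C\<^esub> (1/2) *\<^sub>R (a *\<^sub>R ?A + b *\<^sub>R ?B + c *\<^sub>R ?D + p *\<^sub>R ?P + q *\<^sub>R ?Q)
        + (1/2) *\<^sub>R (a *\<^sub>R ?A + b *\<^sub>R ?D + c *\<^sub>R ?B + p *\<^sub>R ?Q + q *\<^sub>R ?P)"
    using xy yx' by (intro cone_le_add[OF cone] cone_le_scaleR[OF cone]) auto
  also have "(1/2) *\<^sub>R ?r + (1/2) *\<^sub>R ?r = ?r" by (rule *)
  also have "(1/2) *\<^sub>R (a *\<^sub>R ?A + b *\<^sub>R ?B + c *\<^sub>R ?D + p *\<^sub>R ?P + q *\<^sub>R ?Q)
        + (1/2) *\<^sub>R (a *\<^sub>R ?A + b *\<^sub>R ?D + c *\<^sub>R ?B + p *\<^sub>R ?Q + q *\<^sub>R ?P)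
      = a *\<^sub>R ?A + ((b + c) / 2) *\<^sub>R ?B + ((b + c) / 2) *\<^sub>R ?D + ((p + q) / 2) *\<^sub>R (?P + ?Q)"
    using *[of "a *\<^sub>R ?A"] by (simp add: algebra_simps add_divide_distrib)
  finally show "?r \<preceq>\<^bsub>C\<^esub> \<dots>" .
qed (use nn sum in \<open>auto simp: field_simps\<close>)

text \<open>Different alternatives may hold for \<open>(x, y)\<close> and \<open>(y, x)\<close>. A
  Banach or Kannan bound in either order already has the required form, as \<open>b\<close> and
  \<open>c\<close> may differ in \<open>dominated\<close>. Otherwise the Chatterjea bound holds in
  both orders and can be averaged.\<close>

lemma dominated_Zamfirescu:
  assumes X: "f x \<in> X" "f y \<in> X" "g x \<in> X" "g y \<in> X"
    and nn: "0 \<le> a" "0 \<le> b" "0 \<le> c" "0 \<le> p" "0 \<le> q" and le: "a \<le> k" "b + c \<le> k" "p + q \<le> k"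
    and xy: "d (f x) (f y) \<preceq>\<^bsub>C\<^esub> a *\<^sub>R d (g x) (g y)
      \<or> d (f x) (f y) \<preceq>\<^bsub>C\<^esub> b *\<^sub>R d (g x) (f x) + c *\<^sub>R d (g y) (f y)
      \<or> d (f x) (f y) \<preceq>\<^bsub>C\<^esub> p *\<^sub>R d (g x) (f y) + q *\<^sub>R d (g y) (f x)"
    and yx: "d (f y) (f x) \<preceq>\<^bsub>C\<^esub> a *\<^sub>R d (g y) (g x)
      \<or> d (f y) (f x) \<preceq>\<^bsub>C\<^esub> b *\<^sub>R d (g y) (f y) + c *\<^sub>R d (g x) (f x)
      \<or> d (f y) (f x) \<preceq>\<^bsub>C\<^esub> p *\<^sub>R d (g y) (f x) + q *\<^sub>R d (g x) (f y)"
  shows "dominated k f g x y"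
proof -
  have s: "d (f y) (f x) = d (f x) (f y)" "d (g y) (g x) = d (g x) (g y)" using sym X by blast+
  \<comment> \<open>By symmetry of \<open>d\<close>, exchanging the points swaps the roles of
    \<open>b\<close> and \<open>c\<close> in the Kannan bound and of the two cross distances in the
    Chatterjea bound.\<close>
  have yx': "d (f x) (f y) \<preceq>\<^bsub>C\<^esub> a *\<^sub>R d (g x) (g y)
      \<or> d (f x) (f y) \<preceq>\<^bsub>C\<^esub> c *\<^sub>R d (g x) (f x) + b *\<^sub>R d (g y) (f y)
      \<or> d (f x) (f y) \<preceq>\<^bsub>C\<^esub> p *\<^sub>R d (g y) (f x) + q *\<^sub>R d (g x) (f y)"
    using yx by (simp only: s add.commute[of "b *\<^sub>R d (g y) (f y)"])
  consider "d (f x) (f y) \<preceq>\<^bsub>C\<^esub> a *\<^sub>R d (g x) (g y)"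
    | "d (f x) (f y) \<preceq>\<^bsub>C\<^esub> b *\<^sub>R d (g x) (f x) + c *\<^sub>R d (g y) (f y)"
    | "d (f x) (f y) \<preceq>\<^bsub>C\<^esub> c *\<^sub>R d (g x) (f x) + b *\<^sub>R d (g y) (f y)"
    | "d (f x) (f y) \<preceq>\<^bsub>C\<^esub> p *\<^sub>R d (g x) (f y) + q *\<^sub>R d (g y) (f x)"
      "d (f x) (f y) \<preceq>\<^bsub>C\<^esub> p *\<^sub>R d (g y) (f x) + q *\<^sub>R d (g x) (f y)"
    using xy yx' by blast
  then show ?thesis
  proof cases
    case 1
    then show ?thesis using nn le by (intro dominatedI[of a 0 0 0]) auto
  next
    case 2
    then show ?thesis using nn le by (intro dominatedI[of 0 b c 0]) auto
  next
    case 3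
    then show ?thesis using nn le by (intro dominatedI[of 0 c b 0]) auto
  next
    case 4
    then show ?thesis
      using nn le X by (intro dominated_Hardy_Rogers[of f x y g 0 0 0 p q]) (auto simp: s)
  qed
qed

lemma dominated_Ciric:
  assumes k: "0 \<le> k"
    and ex: "\<exists>u. (u \<in> {d (g x) (g y),
                    (d (g x) (f x) + d (g y) (f y)) /\<^sub>R 2,
                    (d (g x) (f y) + d (g y) (f x)) /\<^sub>R 2}
             \<or> u \<in> {d (g x) (g y), d (g x) (f x), d (g y) (f y),
                    (d (g x) (f y) + d (g y) (f x)) /\<^sub>R 2})
              \<and> d (f x) (f y) \<preceq>\<^bsub>C\<^esub> k *\<^sub>R u"
  shows "dominated k f g x y"
proof -
  from ex obtain u where le: "d (f x) (f y) \<preceq>\<^bsub>C\<^esub> k *\<^sub>R u"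
    and "u = d (g x) (g y) \<or> u = d (g x) (f x) \<or> u = d (g y) (f y)
      \<or> u = (d (g x) (f x) + d (g y) (f y)) /\<^sub>R 2 \<or> u = (d (g x) (f y) + d (g y) (f x)) /\<^sub>R 2"
    unfolding insert_iff empty_iff by blast
  then consider "u = d (g x) (g y)" | "u = d (g x) (f x)" | "u = d (g y) (f y)"
    | "u = (d (g x) (f x) + d (g y) (f y)) /\<^sub>R 2" | "u = (d (g x) (f y) + d (g y) (f x)) /\<^sub>R 2"
    by blast
  then show ?thesis
  proof cases
    case 1
    then show ?thesis using k le by (intro dominatedI[of k 0 0 0]) auto
  next
    case 2
    then show ?thesis using k le by (intro dominatedI[of 0 k 0 0]) auto
  next
    case 3
    then show ?thesis using k le by (intro dominatedI[of 0 0 k 0]) auto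
  next
    case 4
    then have "k *\<^sub>R u = (k / 2) *\<^sub>R d (g x) (f x) + (k / 2) *\<^sub>R d (g y) (f y)"
      by (simp add: scaleR_right_distrib)
    then show ?thesis using k le by (intro dominatedI[of 0 "k / 2" "k / 2" 0]) auto
  next
    case 5
    then have "k *\<^sub>R u = (k / 2) *\<^sub>R (d (g x) (f y) + d (g y) (f x))" by simp
    with k le show ?thesis by (intro dominatedI[of 0 0 0 "k / 2"]) auto
  qed
qed

end

section \<open>Reduction of the seven conditions to domination\<close>

theorem theorem4p1:
  fixes C :: "'e::real_topological_vector set"
    and X :: "'x set"
    and d :: "'x \<Rightarrow> 'x \<Rightarrow> 'e"
    and f g :: "'x \<Rightarrow> 'x"
  assumes "cone_metric_space C X d"
    and "solid C"
    and "f \<in> X \<rightarrow> X"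
    and "g \<in> X \<rightarrow> X"
    and "f ` X \<subseteq> g ` X"
    and "cone_complete C d (f ` X) \<or> cone_complete C d (g ` X)"
    and "(\<comment> \<open>Banach\<close>
         \<exists>\<alpha>::real. 0 < \<alpha> \<and> \<alpha> < 1 \<and>
           (\<forall>x\<in>X. \<forall>y\<in>X. d (f x) (f y) \<preceq>\<^bsub>C\<^esub> \<alpha> *\<^sub>R d (g x) (g y)))
      \<or> (\<comment> \<open>Kannan\<close>
         \<exists>\<alpha> \<mu>::real. 0 \<le> \<alpha> \<and> 0 \<le> \<mu> \<and> \<alpha> + \<mu> < 1 \<and>
           (\<forall>x\<in>X. \<forall>y\<in>X. d (f x) (f y) \<preceq>\<^bsub>C\<^esub> \<alpha> *\<^sub>R d (g x) (f x) + \<mu> *\<^sub>R d (g y) (f y)))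
      \<or> (\<comment> \<open>Chatterjea\<close>
         \<exists>\<alpha> \<mu>::real. 0 \<le> \<alpha> \<and> 0 \<le> \<mu> \<and> \<alpha> + \<mu> < 1 \<and>
           (\<forall>x\<in>X. \<forall>y\<in>X. d (f x) (f y) \<preceq>\<^bsub>C\<^esub> \<alpha> *\<^sub>R d (g x) (f y) + \<mu> *\<^sub>R d (g y) (f x)))
      \<or> (\<comment> \<open>Reich\<close>
         \<exists>\<alpha> \<mu> \<nu>::real. 0 \<le> \<alpha> \<and> 0 \<le> \<mu> \<and> 0 \<le> \<nu> \<and> \<alpha> + \<mu> + \<nu> < 1 \<and>
           (\<forall>x\<in>X. \<forall>y\<in>X. d (f x) (f y) \<preceq>\<^bsub>C\<^esub>
              \<alpha> *\<^sub>R d (g x) (g y) + \<mu> *\<^sub>R d (g x) (f x) + \<nu> *\<^sub>R d (g y) (f y)))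
      \<or> (\<comment> \<open>Zamfirescu\<close>
         \<exists>\<alpha>1 \<alpha>2 \<mu>2 \<alpha>3 \<mu>3::real. 0 < \<alpha>1 \<and> \<alpha>1 < 1 \<and>
           0 \<le> \<alpha>2 \<and> 0 \<le> \<mu>2 \<and> \<alpha>2 + \<mu>2 < 1 \<and>
           0 \<le> \<alpha>3 \<and> 0 \<le> \<mu>3 \<and> \<alpha>3 + \<mu>3 < 1 \<and>
           (\<forall>x\<in>X. \<forall>y\<in>X.
              d (f x) (f y) \<preceq>\<^bsub>C\<^esub> \<alpha>1 *\<^sub>R d (g x) (g y)
            \<or> d (f x) (f y) \<preceq>\<^bsub>C\<^esub> \<alpha>2 *\<^sub>R d (g x) (f x) + \<mu>2 *\<^sub>R d (g y) (f y)
            \<or> d (f x) (f y) \<preceq>\<^bsub>C\<^esub> \<alpha>3 *\<^sub>R d (g x) (f y) + \<mu>3 *\<^sub>R d (g y) (f x)))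
      \<or> (\<comment> \<open>Hardy--Rogers\<close>
         \<exists>\<alpha> \<mu> \<nu> \<xi> \<pi>::real. 0 \<le> \<alpha> \<and> 0 \<le> \<mu> \<and> 0 \<le> \<nu> \<and> 0 \<le> \<xi> \<and> 0 \<le> \<pi> \<and>
           \<alpha> + \<mu> + \<nu> + \<xi> + \<pi> < 1 \<and>
           (\<forall>x\<in>X. \<forall>y\<in>X. d (f x) (f y) \<preceq>\<^bsub>C\<^esub>
              \<alpha> *\<^sub>R d (g x) (g y) + \<mu> *\<^sub>R d (g x) (f x) + \<nu> *\<^sub>R d (g y) (f y)
              + \<xi> *\<^sub>R d (g x) (f y) + \<pi> *\<^sub>R d (g y) (f x)))
      \<or> (\<comment> \<open>Ciric\<close>
         \<exists>\<alpha>::real. 0 < \<alpha> \<and> \<alpha> < 1 \<and>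
           (\<forall>x\<in>X. \<forall>y\<in>X. \<exists>u.
              (u \<in> {d (g x) (g y),
                    (d (g x) (f x) + d (g y) (f y)) /\<^sub>R 2,
                    (d (g x) (f y) + d (g y) (f x)) /\<^sub>R 2}
             \<or> u \<in> {d (g x) (g y), d (g x) (f x), d (g y) (f y),
                    (d (g x) (f y) + d (g y) (f x)) /\<^sub>R 2})
              \<and> d (f x) (f y) \<preceq>\<^bsub>C\<^esub> \<alpha> *\<^sub>R u))"
  shows "(\<exists>!w. point_of_coincidence X f g w) \<and>
         (weakly_compatible X f g \<longrightarrow> (\<exists>!x. common_fixed_point X f g x))"
proof -
  interpret cone_metric_space C X d by fact
  have X: "f x \<in> X" "g x \<in> X" if "x \<in> X" for x using that assms(3,4) by auto
  \<comment> \<open>Two templates cover all conditions but the last: Banach, Kannan and Chatterjea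
    are instances of the first and Reich of the second, with zeros for the absent
    coefficients.\<close>
  let ?Zamfirescu = "\<lambda>a b c p q. \<forall>x\<in>X. \<forall>y\<in>X.
        d (f x) (f y) \<preceq>\<^bsub>C\<^esub> a *\<^sub>R d (g x) (g y)
      \<or> d (f x) (f y) \<preceq>\<^bsub>C\<^esub> b *\<^sub>R d (g x) (f x) + c *\<^sub>R d (g y) (f y)
      \<or> d (f x) (f y) \<preceq>\<^bsub>C\<^esub> p *\<^sub>R d (g x) (f y) + q *\<^sub>R d (g y) (f x)"
  let ?Hardy_Rogers = "\<lambda>a b c p q. \<forall>x\<in>X. \<forall>y\<in>X.
      d (f x) (f y) \<preceq>\<^bsub>C\<^esub> a *\<^sub>R d (g x) (g y) + b *\<^sub>R d (g x) (f x) + c *\<^sub>R d (g y) (f y)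
        + p *\<^sub>R d (g x) (f y) + q *\<^sub>R d (g y) (f x)"
  let ?dom = "\<exists>k. 0 \<le> k \<and> k < 1 \<and> (\<forall>x\<in>X. \<forall>y\<in>X. dominated k f g x y)"
  have Zamfirescu: ?dom
    if "0 \<le> a" "0 \<le> b" "0 \<le> c" "0 \<le> p" "0 \<le> q" "a < 1" "b + c < 1" "p + q < 1"
      and "?Zamfirescu a b c p q" for a b c p q
  proof (intro exI conjI ballI)
    \<comment> \<open>The alternative may change from pair to pair, so the uniform factor is the
      largest of the three total weights.\<close>
    let ?k = "max a (max (b + c) (p + q))"
    show "0 \<le> ?k" "?k < 1" using that(1-8) by auto
    show "dominated ?k f g x y" if "x \<in> X" "y \<in> X" for x y
      using \<open>0 \<le> a\<close> \<open>0 \<le> b\<close> \<open>0 \<le> c\<close> \<open>0 \<le> p\<close> \<open>0 \<le> q\<close> \<open>?Zamfirescu a b c p q\<close> that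
      by (intro dominated_Zamfirescu[of f x y g a b c p q] X) auto
  qed
  have Hardy_Rogers: ?dom
    if "0 \<le> a" "0 \<le> b" "0 \<le> c" "0 \<le> p" "0 \<le> q" "a + b + c + p + q < 1"
      and "?Hardy_Rogers a b c p q" for a b c p q
  proof (intro exI conjI ballI)
    let ?k = "a + b + c + p + q"
    show "0 \<le> ?k" "?k < 1" using that(1-6) by auto
    show "dominated ?k f g x y" if "x \<in> X" "y \<in> X" for x y
      using \<open>0 \<le> a\<close> \<open>0 \<le> b\<close> \<open>0 \<le> c\<close> \<open>0 \<le> p\<close> \<open>0 \<le> q\<close> \<open>?Hardy_Rogers a b c p q\<close> that
      by (intro dominated_Hardy_Rogers[of f x y g a b c p q] X) auto
  qed
  from assms(7) have ?dom
  proof (elim disjE, goal_cases)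
    case 1
    then obtain a where "0 < a" "a < 1" "?Zamfirescu a 0 0 0 0" by blast
    then show ?case by (intro Zamfirescu[of a 0 0 0 0]) auto
  next
    case 2
    then obtain b c where "0 \<le> b" "0 \<le> c" "b + c < 1" "?Zamfirescu 0 b c 0 0" by blast
    then show ?case by (intro Zamfirescu[of 0 b c 0 0]) auto
  next
    case 3
    then obtain p q where "0 \<le> p" "0 \<le> q" "p + q < 1" "?Zamfirescu 0 0 0 p q" by blast
    then show ?case by (intro Zamfirescu[of 0 0 0 p q]) auto
  next
    case 4
    then obtain a b c where "0 \<le> a" "0 \<le> b" "0 \<le> c" "a + b + c < 1" "?Hardy_Rogers a b c 0 0"
      by auto
    then show ?case by (intro Hardy_Rogers[of a b c 0 0]) auto
  next
    case 5
    then obtain a b c p q where "0 < a" "a < 1" "0 \<le> b" "0 \<le> c" "b + c < 1"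
      "0 \<le> p" "0 \<le> q" "p + q < 1" "?Zamfirescu a b c p q" by blast
    then show ?case by (intro Zamfirescu[of a b c p q]) auto
  next
    case 6
    then obtain a b c p q where "0 \<le> a" "0 \<le> b" "0 \<le> c" "0 \<le> p" "0 \<le> q"
      "a + b + c + p + q < 1" "?Hardy_Rogers a b c p q" by blast
    then show ?case by (rule Hardy_Rogers)
  next
    case 7
    then show ?case
    \<comment> \<open>The Ciric constant itself serves as the domination factor.\<close>
    proof (elim exE conjE, goal_cases)
      case (1 k)
      have "dominated k f g x y" if "x \<in> X" "y \<in> X" for x y
        using dominated_Ciric[OF less_imp_le[OF 1(1)] bspec[OF bspec[OF 1(3) that(1)] that(2)]] .
      with 1(1,2) show ?case by (intro exI[of _ k]) auto
    qed
  qed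
  then obtain k where "0 \<le> k" "k < 1" "\<And>x y. x \<in> X \<Longrightarrow> y \<in> X \<Longrightarrow> dominated k f g x y"
    by blast
  from coincidence_and_common_fixed_point[OF assms(3,4) this assms(2,5,6)]
  show ?thesis .
qed

end
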